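(* Let $p\ge 0$ be an integer and let $\{\phi_0,\dots,\phi_p\}$ be a basis of the real vector space $\mathbb{P}^p$ of univariate real polynomials of degree at most $p$; write $\boldsymbol{\phi}(x)=[\phi_0(x),\dots,\phi_p(x)]^T\in\mathbb{R}^{p+1}$. Let $\Omega_b\subset\mathbb{R}$ be the boundary cell, a closed interval of length $\Delta x>0$, and let $M\in\mathbb{R}^{(p+1)\times(p+1)}$ be its mass matrix, $M_{mn}=\int_{\Omega_b}\phi_m(x)\phi_n(x)\,dx$. Let $\tilde x$ be the computational boundary point (an endpoint of $\Omega_b$), and let $\bar x=\tilde x+d$ with $d\in[-\Delta x,\Delta x]$ be the real boundary point. For every $\mathbf{u}\in\mathbb{R}^{p+1}$ and $u_D\in\mathbb{R}$, let $(\mathbf{v},\lambda)\in\mathbb{R}^{p+1}\times\mathbb{R}$ be the (unique) solution of the ROD-$L^2$ linear system $$\begin{bmatrix} M & \boldsymbol{\phi}(\bar x)\\ \boldsymbol{\phi}(\bar x)^T & 0\end{bmatrix}\begin{bmatrix}\mathbf{v}\\ \lambda\end{bmatrix}=\begin{bmatrix}M\mathbf{u}\\ u_D\end{bmatrix},$$ and let $v_h(x)=\boldsymbol{\phi}(x)^T\mathbf{v}$. Then computing $v_h(\tilde x)$ in this way is equivalent to the polynomial correction $$v_h(\tilde x)=[\boldsymbol{\phi}^{\text{ROD-}L^2}(\tilde x)]^T\mathbf{u}+\alpha^{\text{ROD-}L^2}(\tilde x)\,u_D,$$ i.e. this equality holds for all $\mathbf{u}$ and $u_D$, where $$\alpha^{\text{ROD-}L^2}(\tilde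 x)=\frac{\boldsymbol{\phi}(\tilde x)^TM^{-1}\boldsymbol{\phi}(\bar x)}{\boldsymbol{\phi}(\bar x)^TM^{-1}\boldsymbol{\phi}(\bar x)},\qquad \boldsymbol{\phi}^{\text{ROD-}L^2}(\tilde x)=\boldsymbol{\phi}(\tilde x)-\alpha^{\text{ROD-}L^2}(\tilde x)\,\boldsymbol{\phi}(\bar x).$$
   Context: Setting: in a one-dimensional discontinuous Galerkin method, the numerical solution in the boundary cell $\Omega_b$ is the polynomial $u_h(x)=\boldsymbol{\phi}(x)^T\mathbf{u}$, with coefficient vector $\mathbf{u}=[u_0,\dots,u_p]^T$ in the basis $\{\phi_n\}_{n=0}^p$. Basis functions are polynomials and are evaluated also outside the cell. A Dirichlet value $u_D$ is prescribed at the real boundary point $\bar x$, which need not coincide with the computational boundary point $\tilde x$. The ROD-$L^2$ (Reconstruction for Off-site Data, $L^2$ distance) method defines a modified polynomial $v_h(x)=\boldsymbol{\phi}(x)^T\mathbf{v}$ whose coefficients $\mathbf{v}$ minimize $\frac12\int_{\Omega_b}(v_h(x)-u_h(x))^2\,dx$ subject to the constraint $v_h(\bar x)=u_D$. The linear system in the claim consists of the optimality conditions of the Lagrangian $\mathcal{L}(\mathbf{v},\lambda)=\frac12\int_{\Omega_b}(v_h-u_h)^2\,dx+\lambda(v_h(\bar x)-u_D)$. The value $v_h(\tilde x)$ is the modified boundary condition imposed at $\tilde x$. *)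

theory Defs
  imports
    "HOL-Analysis.Analysis"
    "Jordan_Normal_Form.Gauss_Jordan_Elimination"
begin

no_notation inner (infix \<open>\<bullet>\<close> 70)

global_interpretation poly_space: vector_space "Polynomial.smult :: real \<Rightarrow> real poly \<Rightarrow> real poly"
  by unfold_locales (simp_all add: smult_add_right smult_add_left)

text \<open>A family, not a set: the members \<open>\<phi> 0, \<dots>, \<phi> p\<close> are required to be distinct.
  Values of \<open>\<phi>\<close> at indices above \<open>p\<close> are irrelevant.\<close>

definition is_poly_basis :: "nat \<Rightarrow> (nat \<Rightarrow> real poly) \<Rightarrow> bool" where
  "is_poly_basis p \<phi> \<longleftrightarrow>
     inj_on \<phi> {0..p} \<and>
     poly_space.independent (\<phi> ` {0..p}) \<and>
     poly_space.span (\<phi> ` {0..p}) = {q. degree q \<le> p}"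

definition basis_vec :: "nat \<Rightarrow> (nat \<Rightarrow> real poly) \<Rightarrow> real \<Rightarrow> real Matrix.vec" where
  "basis_vec p \<phi> x = Matrix.vec (p + 1) (\<lambda>n. poly (\<phi> n) x)"

definition dg_poly :: "nat \<Rightarrow> (nat \<Rightarrow> real poly) \<Rightarrow> real Matrix.vec \<Rightarrow> real \<Rightarrow> real" where
  "dg_poly p \<phi> v x = basis_vec p \<phi> x \<bullet> v"

definition mass_matrix :: "nat \<Rightarrow> (nat \<Rightarrow> real poly) \<Rightarrow> real set \<Rightarrow> real Matrix.mat" where
  "mass_matrix p \<phi> \<Omega> =
     Matrix.mat (p + 1) (p + 1) (\<lambda>(m, n). integral \<Omega> (\<lambda>x. poly (\<phi> m) x * poly (\<phi> n) x))"

text \<open>Only meaningful for invertible matrices: \<^const>\<open>mat_inverse\<close> returns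
  \<^const>\<open>None\<close> on singular ones.\<close>

definition mat_inv :: "real Matrix.mat \<Rightarrow> real Matrix.mat" where
  "mat_inv A = the (mat_inverse A)"

definition rod_matrix :: "nat \<Rightarrow> (nat \<Rightarrow> real poly) \<Rightarrow> real set \<Rightarrow> real \<Rightarrow> real Matrix.mat" where
  "rod_matrix p \<phi> \<Omega> xbar =
     four_block_mat
       (mass_matrix p \<phi> \<Omega>)                       (mat_of_cols (p + 1) [basis_vec p \<phi> xbar])
       (mat_of_rows (p + 1) [basis_vec p \<phi> xbar]) (0\<^sub>m 1 1)"

definition rod_rhs ::
  "nat \<Rightarrow> (nat \<Rightarrow> real poly) \<Rightarrow> real set \<Rightarrow> real Matrix.vec \<Rightarrow> real \<Rightarrow> real Matrix.vec" where
  "rod_rhs p \<phi> \<Omega> u uD = (mass_matrix p \<phi> \<Omega> *\<^sub>v u) @\<^sub>v vec_of_list [uD]"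

definition rod_solution ::
  "nat \<Rightarrow> (nat \<Rightarrow> real poly) \<Rightarrow> real set \<Rightarrow> real \<Rightarrow> real Matrix.vec \<Rightarrow> real
    \<Rightarrow> real Matrix.vec \<times> real \<Rightarrow> bool" where
  "rod_solution p \<phi> \<Omega> xbar u uD = (\<lambda>(v, l).
     v \<in> carrier_vec (p + 1) \<and>
     rod_matrix p \<phi> \<Omega> xbar *\<^sub>v (v @\<^sub>v vec_of_list [l]) = rod_rhs p \<phi> \<Omega> u uD)"

definition rod_alpha :: "nat \<Rightarrow> (nat \<Rightarrow> real poly) \<Rightarrow> real set \<Rightarrow> real \<Rightarrow> real \<Rightarrow> real" where
  "rod_alpha p \<phi> \<Omega> xbar xt =
     (basis_vec p \<phi> xt \<bullet> (mat_inv (mass_matrix p \<phi> \<Omega>) *\<^sub>v basis_vec p \<phi> xbar)) /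
     (basis_vec p \<phi> xbar \<bullet> (mat_inv (mass_matrix p \<phi> \<Omega>) *\<^sub>v basis_vec p \<phi> xbar))"

definition rod_basis_vec ::
  "nat \<Rightarrow> (nat \<Rightarrow> real poly) \<Rightarrow> real set \<Rightarrow> real \<Rightarrow> real \<Rightarrow> real Matrix.vec" where
  "rod_basis_vec p \<phi> \<Omega> xbar xt =
     basis_vec p \<phi> xt - rod_alpha p \<phi> \<Omega> xbar xt \<cdot>\<^sub>v basis_vec p \<phi> xbar"

end

theory Submission
  imports Defs "Jordan_Normal_Form.Determinant"
begin

text \<open>The mass matrix \<open>M\<close> is the Gram matrix of the basis for the \<open>L\<^sup>2\<close> product on the cell, so
  \<open>w\<^sup>T M w = \<integral> w\<^sub>h\<^sup>2\<close> and \<open>M\<close> is positive definite. The constant \<open>1\<close> lies in the span of the basis,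
  hence \<open>\<phi>(x) \<noteq> 0\<close> at every point, in or outside the cell, and \<open>\<phi>(x)\<^sup>T M\<^sup>-\<^sup>1 \<phi>(x) > 0\<close>. Block
  elimination then solves the system: \<open>v = u - \<lambda> M\<^sup>-\<^sup>1 \<phi>(xbar)\<close>, and the constraint fixes \<open>\<lambda>\<close>.\<close>

text \<open>A trivial kernel makes the determinant nonzero, hence \<open>A\<close> a unit of the
  matrix ring, and on units \<open>mat_inverse\<close> does not return \<open>None\<close>. This
  gives \<open>mat_inv\<close>, defined through \<open>the\<close>, its intended value.\<close>

lemma invertible_mat_if_trivial_kernel:
  fixes A :: "'a :: field mat"
  assumes A: "A \<in> carrier_mat n n"
    and ker: "\<And>v. v \<in> carrier_vec n \<Longrightarrow> A *\<^sub>v v = 0\<^sub>v n \<Longrightarrow> v = 0\<^sub>v n"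
  obtains B where "mat_inverse A = Some B" "B \<in> carrier_mat n n"
    "A * B = 1\<^sub>m n" "B * A = 1\<^sub>m n"
proof -
  have "Determinant.det A \<noteq> 0"
    using det_0_iff_vec_prod_zero[OF A] ker by blast
  then have "A \<in> Units (ring_mat TYPE('a) n ())"
    by (rule det_non_zero_imp_unit[OF A])
  then obtain B where "mat_inverse A = Some B"
    using mat_inverse(1)[OF A, of "()"] by (cases "mat_inverse A") auto
  then show thesis
    using mat_inverse(2)[OF A] that by blast
qed

text \<open>Block elimination: the first row determines \<open>v\<close> in terms of
  \<open>l\<close>, and inserting it into the constraint leaves one scalar equation for
  \<open>l\<close> with coefficient \<open>c \<bullet> (N *\<^sub>v c)\<close>, the Schur complement
  up to sign. As an equivalence it yields existence and uniqueness together.\<close>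

lemma saddle_point_iff:
  fixes M :: "'a :: field mat"
  assumes carrier: "M \<in> carrier_mat n n" "N \<in> carrier_mat n n"
    and inv: "M * N = 1\<^sub>m n" "N * M = 1\<^sub>m n"
    and vecs: "c \<in> carrier_vec n" "u \<in> carrier_vec n" "v \<in> carrier_vec n"
    and nz: "c \<bullet> (N *\<^sub>v c) \<noteq> 0"
  shows "M *\<^sub>v v + l \<cdot>\<^sub>v c = M *\<^sub>v u \<and> c \<bullet> v = r \<longleftrightarrow>
    l = (c \<bullet> u - r) / (c \<bullet> (N *\<^sub>v c)) \<and> v = u - l \<cdot>\<^sub>v (N *\<^sub>v c)"
proof -
  define w where "w = N *\<^sub>v c"
  have w: "w \<in> carrier_vec n"
    using carrier vecs by (simp add: w_def)
  have Mw: "M *\<^sub>v w = c"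
    using assoc_mult_mat_vec[OF carrier(1) carrier(2) vecs(1)] inv vecs by (simp add: w_def)
  have cancel: "N *\<^sub>v (M *\<^sub>v x) = x" if "x \<in> carrier_vec n" for x
    using assoc_mult_mat_vec[OF carrier(2) carrier(1) that] inv that by simp
  have M_lin: "M *\<^sub>v (u - l \<cdot>\<^sub>v w) = M *\<^sub>v u - l \<cdot>\<^sub>v c"
    using mult_minus_distrib_mat_vec[OF carrier(1) vecs(2), of "l \<cdot>\<^sub>v w"]
      mult_mat_vec[OF carrier(1) w, of l] w Mw by simp
  have "M *\<^sub>v v + l \<cdot>\<^sub>v c = M *\<^sub>v u \<longleftrightarrow> M *\<^sub>v v = M *\<^sub>v u - l \<cdot>\<^sub>v c"
  proof -
    have "M *\<^sub>v v \<in> carrier_vec n" "M *\<^sub>v u \<in> carrier_vec n" "l \<cdot>\<^sub>v c \<in> carrier_vec n"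
      using carrier vecs by auto
    then show ?thesis
      by (auto simp: vec_eq_iff algebra_simps)
  qed
  \<comment> \<open>By \<open>M_lin\<close> the right side is \<open>M\<close> applied to
    \<open>u - l \<cdot>\<^sub>v w\<close>; applying \<open>N\<close> to both sides cancels
    \<open>M\<close>.\<close>
  also have "\<dots> \<longleftrightarrow> v = u - l \<cdot>\<^sub>v w"
    using cancel[of v] cancel[of "u - l \<cdot>\<^sub>v w"] M_lin vecs w by auto
  finally have first: "M *\<^sub>v v + l \<cdot>\<^sub>v c = M *\<^sub>v u \<longleftrightarrow> v = u - l \<cdot>\<^sub>v w" .
  have "c \<bullet> (u - l \<cdot>\<^sub>v w) = c \<bullet> u - l * (c \<bullet> w)"
    using scalar_prod_minus_distrib[OF vecs(1) vecs(2), of "l \<cdot>\<^sub>v w"] vecs w by simp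
  then have "c \<bullet> (u - l \<cdot>\<^sub>v w) = r \<longleftrightarrow> l = (c \<bullet> u - r) / (c \<bullet> w)"
    using nz by (simp add: eq_divide_eq flip: w_def) (metis diff_eq_eq eq_diff_eq add.commute)
  with first show ?thesis
    unfolding w_def by blast
qed

text \<open>Blockwise multiplication separates the bordered system into the optimality row and the
  constraint row, the two equations that \<open>saddle_point_iff\<close> treats.\<close>

lemma four_block_border_mult_vec:
  fixes M :: "'a :: comm_semiring_1 mat"
  assumes M: "M \<in> carrier_mat n n" and vecs: "c \<in> carrier_vec n" "v \<in> carrier_vec n"
  shows "four_block_mat M (mat_of_cols n [c]) (mat_of_rows n [c]) (0\<^sub>m 1 1) *\<^sub>v (v @\<^sub>v vec_of_list [l]) =
    (M *\<^sub>v v + l \<cdot>\<^sub>v c) @\<^sub>v vec_of_list [c \<bullet> v]"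
proof -
  have l: "vec_of_list [l] \<in> carrier_vec 1"
    by (metis carrier_vec_dim_vec dim_vec_of_list length_Cons list.size(3) One_nat_def)
  have col: "mat_of_cols n [c] *\<^sub>v vec_of_list [l] = l \<cdot>\<^sub>v c"
    using vecs
    by (auto simp: vec_eq_iff mat_of_cols_def scalar_prod_def vec_of_list_index mult.commute)
  have row: "mat_of_rows n [c] *\<^sub>v v + 0\<^sub>m 1 1 *\<^sub>v vec_of_list [l] = vec_of_list [c \<bullet> v]"
    using vecs
    by (auto simp: vec_eq_iff scalar_prod_def vec_of_list_index mat_of_rows_row)
  have "mat_of_cols n [c] \<in> carrier_mat n 1" "mat_of_rows n [c] \<in> carrier_mat 1 n"
    by (simp_all add: carrier_matI)
  from four_block_mat_mult_vec[OF M this zero_carrier_mat vecs(2) l] show ?thesis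
    by (simp only: col row)
qed

lemma basis_vec_carrier [simp]: "basis_vec p \<phi> x \<in> carrier_vec (p + 1)"
  by (simp add: basis_vec_def)

lemma mass_matrix_carrier [simp]: "mass_matrix p \<phi> \<Omega> \<in> carrier_mat (p + 1) (p + 1)"
  by (simp add: mass_matrix_def)

lemma dg_poly_eq_sum:
  assumes "v \<in> carrier_vec (p + 1)"
  shows "dg_poly p \<phi> v x = (\<Sum>n\<le>p. v $ n * poly (\<phi> n) x)"
  using assms
  by (auto simp: dg_poly_def basis_vec_def scalar_prod_def mult.commute atLeast0LessThan
      lessThan_Suc_atMost intro!: sum.cong)

text \<open>The Gram matrix property: both polynomials are expanded in the basis and the finite
  double sum is interchanged with the integral.\<close>

lemma mass_matrix_bilinear:
  assumes "v \<in> carrier_vec (p + 1)" "w \<in> carrier_vec (p + 1)"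
  shows "v \<bullet> (mass_matrix p \<phi> {a..b} *\<^sub>v w) = integral {a..b} (\<lambda>x. dg_poly p \<phi> v x * dg_poly p \<phi> w x)"
proof -
  have int: "(\<lambda>x. v $ m * poly (\<phi> m) x * (w $ n * poly (\<phi> n) x)) integrable_on {a..b}" for m n
    by (intro integrable_continuous_real continuous_intros)
  have "integral {a..b} (\<lambda>x. dg_poly p \<phi> v x * dg_poly p \<phi> w x) =
    integral {a..b} (\<lambda>x. \<Sum>m\<le>p. \<Sum>n\<le>p. v $ m * poly (\<phi> m) x * (w $ n * poly (\<phi> n) x))"
    unfolding dg_poly_eq_sum[OF assms(1)] dg_poly_eq_sum[OF assms(2)] sum_product ..
  also have "\<dots> = (\<Sum>m\<le>p. \<Sum>n\<le>p. integral {a..b} (\<lambda>x. v $ m * poly (\<phi> m) x * (w $ n * poly (\<phi> n) x)))"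
    by (subst integral_sum; (intro finite_atMost integrable_sum int)?)
       (intro sum.cong refl integral_sum finite_atMost int)
  also have "\<dots> = (\<Sum>m\<le>p. \<Sum>n\<le>p. v $ m * (integral {a..b} (\<lambda>x. poly (\<phi> m) x * poly (\<phi> n) x) * w $ n))"
  proof (intro sum.cong refl)
    fix m n
    have "(\<lambda>x. v $ m * poly (\<phi> m) x * (w $ n * poly (\<phi> n) x)) =
      (\<lambda>x. (v $ m * w $ n) * (poly (\<phi> m) x * poly (\<phi> n) x))"
      by (auto simp: mult_ac)
    then show "integral {a..b} (\<lambda>x. v $ m * poly (\<phi> m) x * (w $ n * poly (\<phi> n) x)) =
      v $ m * (integral {a..b} (\<lambda>x. poly (\<phi> m) x * poly (\<phi> n) x) * w $ n)"
      by (simp only: integral_mult_right mult_ac)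
  qed
  also have "\<dots> = v \<bullet> (mass_matrix p \<phi> {a..b} *\<^sub>v w)"
    using assms
    by (auto simp: scalar_prod_def mass_matrix_def atLeast0LessThan lessThan_Suc_atMost
        sum_distrib_left intro!: sum.cong)
  finally show ?thesis by simp
qed

text \<open>A polynomial with a nondegenerate interval of roots is zero, and linear independence of
  the basis then forces all its coefficients to vanish.\<close>

lemma dg_poly_zero_on_cell_imp_zero:
  assumes basis: "is_poly_basis p \<phi>" and w: "w \<in> carrier_vec (p + 1)"
    and "a < b" and zero: "\<And>x. x \<in> {a..b} \<Longrightarrow> dg_poly p \<phi> w x = 0"
  shows "w = 0\<^sub>v (p + 1)"
proof -
  define q where "q = (\<Sum>n\<le>p. Polynomial.smult (w $ n) (\<phi> n))"
  have "poly q x = dg_poly p \<phi> w x" for x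
    by (simp add: q_def dg_poly_eq_sum[OF w] poly_sum)
  then have "{a..b} \<subseteq> {x. poly q x = 0}"
    using zero by auto
  then have q: "q = 0"
    using \<open>a < b\<close> poly_roots_finite[of q] infinite_Icc finite_subset by blast
  have inj: "inj_on \<phi> {..p}" and indep: "poly_space.independent (\<phi> ` {..p})"
    using basis by (auto simp: is_poly_basis_def atLeast0AtMost)
  \<comment> \<open>\<open>independentD\<close> expects coefficients indexed by the polynomials
    themselves; injectivity of \<open>\<phi>\<close> lets \<open>the_inv_into\<close> recover the
    index \<open>n\<close>.\<close>
  have "(\<Sum>f\<in>\<phi> ` {..p}. Polynomial.smult (w $ the_inv_into {..p} \<phi> f) f) = q"
    unfolding q_def by (subst sum.reindex[OF inj]) (auto simp: the_inv_into_f_f[OF inj] intro!: sum.cong)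
  then have "w $ the_inv_into {..p} \<phi> (\<phi> n) = 0" if "n \<le> p" for n
    using poly_space.independentD[OF indep, of "\<phi> ` {..p}" "\<lambda>f. w $ the_inv_into {..p} \<phi> f" "\<phi> n"]
      q that by simp
  then have "w $ n = 0" if "n \<le> p" for n
    using that by (simp add: the_inv_into_f_f[OF inj])
  then show ?thesis
    using w by (auto simp: vec_eq_iff)
qed

text \<open>The quadratic form is the integral of a continuous square, which vanishes only if the
  square vanishes on the whole cell.\<close>

lemma mass_matrix_definite:
  assumes basis: "is_poly_basis p \<phi>" and "a < b"
    and w: "w \<in> carrier_vec (p + 1)" "w \<noteq> 0\<^sub>v (p + 1)"
  shows "w \<bullet> (mass_matrix p \<phi> {a..b} *\<^sub>v w) \<noteq> 0"
proof
  have cont: "continuous_on {a..b} (\<lambda>x. dg_poly p \<phi> w x * dg_poly p \<phi> w x)"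
    unfolding dg_poly_eq_sum[OF w(1)] by (intro continuous_intros)
  assume "w \<bullet> (mass_matrix p \<phi> {a..b} *\<^sub>v w) = 0"
  then have "\<forall>x\<in>{a..b}. dg_poly p \<phi> w x = 0"
    using integral_eq_0_iff[OF cont \<open>a < b\<close>] by (simp add: mass_matrix_bilinear[OF w(1) w(1)])
  then show False
    using dg_poly_zero_on_cell_imp_zero[OF basis w(1) \<open>a < b\<close>] w(2) by blast
qed

text \<open>A common root of the basis functions would be a root of everything in their span,
  including the constant \<open>1\<close>. The point \<open>x\<close> is arbitrary, so
  \<open>xbar\<close> may lie outside the cell.\<close>

lemma basis_vec_nonzero:
  assumes basis: "is_poly_basis p \<phi>"
  shows "basis_vec p \<phi> x \<noteq> 0\<^sub>v (p + 1)"
proof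
  assume "basis_vec p \<phi> x = 0\<^sub>v (p + 1)"
  then have zero: "poly (\<phi> n) x = 0" if "n \<le> p" for n
    using that by (auto simp: basis_vec_def vec_eq_iff)
  have "1 \<in> poly_space.span (\<phi> ` {0..p})"
    using basis by (simp add: is_poly_basis_def)
  then obtain c where one: "1 = (\<Sum>f\<in>\<phi> ` {0..p}. Polynomial.smult (c f) f)"
    by (auto simp: poly_space.span_finite)
  have "poly 1 x = (\<Sum>f\<in>\<phi> ` {0..p}. c f * poly f x)"
    by (subst one) (simp add: poly_sum)
  also have "\<dots> = 0"
    by (intro sum.neutral) (auto simp: zero)
  finally show False by simp
qed

text \<open>The first two conjuncts ensure that the formulas mean what they should: otherwise
  \<open>mat_inv\<close> could be the unspecified \<open>the None\<close>, or
  \<open>rod_alpha\<close> a division by zero.\<close>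

theorem proposition5p2:
  fixes p :: nat and \<phi> :: "nat \<Rightarrow> real poly"
    and a b \<Delta>x xt d xbar :: real and \<Omega> :: "real set"
  assumes basis: "is_poly_basis p \<phi>"
    and cell: "\<Omega> = {a..b}" "b - a = \<Delta>x" "\<Delta>x > 0"
    and comp_bd: "xt \<in> {a, b}"
    and real_bd: "xbar = xt + d" "d \<in> {-\<Delta>x..\<Delta>x}"
  shows "invertible_mat (mass_matrix p \<phi> \<Omega>) \<and>
    basis_vec p \<phi> xbar \<bullet> (mat_inv (mass_matrix p \<phi> \<Omega>) *\<^sub>v basis_vec p \<phi> xbar) \<noteq> 0 \<and>
    (\<forall>u \<in> carrier_vec (p + 1). \<forall>uD.
      (\<exists>!s. rod_solution p \<phi> \<Omega> xbar u uD s) \<and>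
      (\<forall>v l. rod_solution p \<phi> \<Omega> xbar u uD (v, l) \<longrightarrow>
        dg_poly p \<phi> v xt =
          rod_basis_vec p \<phi> \<Omega> xbar xt \<bullet> u + rod_alpha p \<phi> \<Omega> xbar xt * uD))"
proof -
  define M where "M = mass_matrix p \<phi> \<Omega>"
  define c where "c = basis_vec p \<phi> xbar"
  define t where "t = basis_vec p \<phi> xt"
  have M: "M \<in> carrier_mat (p + 1) (p + 1)"
    and c: "c \<in> carrier_vec (p + 1)" and t: "t \<in> carrier_vec (p + 1)"
    unfolding M_def c_def t_def by (rule mass_matrix_carrier basis_vec_carrier)+
  have "a < b" using cell by simp
  have pos: "w \<bullet> (M *\<^sub>v w) \<noteq> 0" if "w \<in> carrier_vec (p + 1)" "w \<noteq> 0\<^sub>v (p + 1)" for w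
    using mass_matrix_definite[OF basis \<open>a < b\<close> that] by (simp add: M_def cell)
  obtain N where N: "mat_inverse M = Some N" "N \<in> carrier_mat (p + 1) (p + 1)"
    "M * N = 1\<^sub>m (p + 1)" "N * M = 1\<^sub>m (p + 1)"
  proof (rule invertible_mat_if_trivial_kernel[OF M])
    fix v assume v: "v \<in> carrier_vec (p + 1)" "M *\<^sub>v v = 0\<^sub>v (p + 1)"
    then show "v = 0\<^sub>v (p + 1)"
      using pos[of v] by auto
  qed
  have "invertible_mat M"
    using M N unfolding invertible_mat_def inverts_mat_def by (auto intro!: exI[of _ N])
  have mat_inv: "mat_inv M = N"
    by (simp add: mat_inv_def N)
  define w where "w = N *\<^sub>v c"
  have w: "w \<in> carrier_vec (p + 1)"
    using N c by (simp add: w_def)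
  have Mw: "M *\<^sub>v w = c"
    using assoc_mult_mat_vec[OF M N(2) c] N c by (simp add: w_def)
  \<comment> \<open>The denominator \<open>c \<bullet> w\<close> equals
    \<open>w \<bullet> (M *\<^sub>v w)\<close> because \<open>M *\<^sub>v w = c\<close>, so
    definiteness of \<open>M\<close> itself suffices once \<open>w\<close> is nonzero;
    \<open>w\<close> cannot be zero since \<open>c\<close> is not.\<close>
  have "M *\<^sub>v 0\<^sub>v (p + 1) = 0\<^sub>v (p + 1)"
    using M by (intro eq_vecI) auto
  then have "w \<noteq> 0\<^sub>v (p + 1)"
    using Mw basis_vec_nonzero[OF basis, of xbar] by (auto simp: c_def)
  then have nz: "c \<bullet> w \<noteq> 0"
    using pos[OF w] comm_scalar_prod[OF w c] by (simp add: Mw)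
  define \<alpha> where "\<alpha> = (t \<bullet> w) / (c \<bullet> w)"
  have \<alpha>: "rod_alpha p \<phi> \<Omega> xbar xt = \<alpha>"
    by (simp add: rod_alpha_def \<alpha>_def w_def mat_inv flip: M_def c_def t_def)
  have solution_iff: "rod_solution p \<phi> \<Omega> xbar u r (v, l) \<longleftrightarrow>
      l = (c \<bullet> u - r) / (c \<bullet> w) \<and> v = u - l \<cdot>\<^sub>v w"
    if u: "u \<in> carrier_vec (p + 1)" for u v l r
  proof (cases "v \<in> carrier_vec (p + 1)")
    case True
    have "M *\<^sub>v v + l \<cdot>\<^sub>v c \<in> carrier_vec (p + 1)" "M *\<^sub>v u \<in> carrier_vec (p + 1)"
      using mult_mat_vec_carrier[OF M True] mult_mat_vec_carrier[OF M u] c by simp_all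
    moreover have "vec_of_list [x] = vec_of_list [y] \<longleftrightarrow> x = y" for x y :: real
      by (metis list_vec list.inject)
    ultimately have "rod_solution p \<phi> \<Omega> xbar u r (v, l) \<longleftrightarrow>
        M *\<^sub>v v + l \<cdot>\<^sub>v c = M *\<^sub>v u \<and> c \<bullet> v = r"
      using True append_vec_eq
      unfolding rod_solution_def rod_matrix_def rod_rhs_def M_def[symmetric] c_def[symmetric]
        case_prod_conv four_block_border_mult_vec[OF M c True]
      by blast
    also have "\<dots> \<longleftrightarrow> l = (c \<bullet> u - r) / (c \<bullet> w) \<and> v = u - l \<cdot>\<^sub>v w"
      unfolding w_def
      by (rule saddle_point_iff[OF M N(2-4) c u True nz[unfolded w_def]])
    finally show ?thesis .
  next
    \<comment> \<open>Both sides fail: \<open>rod_solution\<close> demands the dimension of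
      \<open>v\<close>, and the explicit formula enforces it.\<close>
    case False
    then show ?thesis
      using u w by (auto simp: rod_solution_def)
  qed
  have value_at: "t \<bullet> v = (t - \<alpha> \<cdot>\<^sub>v c) \<bullet> u + \<alpha> * r"
    if u: "u \<in> carrier_vec (p + 1)" and v: "v = u - l \<cdot>\<^sub>v w" and l: "l = (c \<bullet> u - r) / (c \<bullet> w)"
    for u v l r
  proof -
    have "t \<bullet> v = t \<bullet> u - l * (t \<bullet> w)"
      using scalar_prod_minus_distrib[OF t u, of "l \<cdot>\<^sub>v w"] t w by (simp add: v)
    moreover have "(t - \<alpha> \<cdot>\<^sub>v c) \<bullet> u = t \<bullet> u - \<alpha> * (c \<bullet> u)"
      using minus_scalar_prod_distrib[OF t _ u, of "\<alpha> \<cdot>\<^sub>v c"] c u by simp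
    \<comment> \<open>Since \<open>l\<close> and \<open>\<alpha>\<close> share the denominator
      \<open>c \<bullet> w\<close>, the product \<open>l * (t \<bullet> w)\<close> is
      \<open>\<alpha>\<close> times the constraint residual \<open>c \<bullet> u - r\<close> of the
      uncorrected polynomial.\<close>
    moreover have "l * (t \<bullet> w) = \<alpha> * (c \<bullet> u) - \<alpha> * r"
      by (simp add: l \<alpha>_def right_diff_distrib left_diff_distrib diff_divide_distrib mult.commute)
    ultimately show ?thesis by simp
  qed
  have "\<exists>!s. rod_solution p \<phi> \<Omega> xbar u r s" if u: "u \<in> carrier_vec (p + 1)" for u r
  proof (rule ex1I)
    let ?l = "(c \<bullet> u - r) / (c \<bullet> w)"
    show "rod_solution p \<phi> \<Omega> xbar u r (u - ?l \<cdot>\<^sub>v w, ?l)"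
      by (simp add: solution_iff[OF u])
    show "s = (u - ?l \<cdot>\<^sub>v w, ?l)" if "rod_solution p \<phi> \<Omega> xbar u r s" for s
      using that by (cases s) (simp add: solution_iff[OF u])
  qed
  moreover have "dg_poly p \<phi> v xt =
      rod_basis_vec p \<phi> \<Omega> xbar xt \<bullet> u + rod_alpha p \<phi> \<Omega> xbar xt * r"
    if "u \<in> carrier_vec (p + 1)" "rod_solution p \<phi> \<Omega> xbar u r (v, l)" for u v l r
    using value_at[OF that(1), of v l r] that
    by (simp add: solution_iff dg_poly_def rod_basis_vec_def \<alpha> flip: t_def c_def)
  ultimately show ?thesis
    using \<open>invertible_mat M\<close> nz by (simp add: mat_inv w_def flip: M_def c_def)
qed

end
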